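(* Let $\mathcal{A}=(A,\to_\mathcal{A})$ be an abstract reduction system, let $E\subseteq\mathrm{NF}_\mathcal{A}$, and let $P\Rightarrow Q$ be a safety APR predicate for $E$ w.r.t. $\mathcal{A}$. Let $\mathsf{any}$ be a fresh element not in $A$, and let $\mathcal{A}'=(A\cup\{\mathsf{any}\},\ {\to_\mathcal{A}}\cup\{(s,\mathsf{any})\mid s\in A\setminus E\})$. Then $P\Rightarrow Q$ is partially valid w.r.t. $\mathcal{A}$ if and only if $P\Rightarrow\{\mathsf{any}\}$ is partially valid w.r.t. $\mathcal{A}'$.
   Context: An abstract reduction system (ARS) is a pair $\mathcal{B}=(B,\to_\mathcal{B})$ of a set $B$ and a binary relation on $B$; $\to_\mathcal{B}^*$ is its reflexive-transitive closure; $\mathrm{NF}_\mathcal{B}$ is the set of normal forms; $\Delta_\mathcal{B}(P)=\{t\mid\exists s\in P.\ s\to_\mathcal{B}t\}$; $P$ is $\mathcal{B}$-runnable if $P\neq\emptyset$ and $P\cap\mathrm{NF}_\mathcal{B}=\emptyset$. An APR predicate over $B$ is a pair $P\Rightarrow Q$ with $P,Q\subseteq B$. $P\Rightarrow Q$ is partially valid w.r.t. $\mathcal{B}$ if it lies in the greatest fixed point of the functional (mapping a set $X$ of predicates to the conclusions of rule instances with all premises in $X$ and side conditions true) of the rules (Subsumption) no premises, conclude $P\Rightarrow Q$ if $P\subseteq Q$; (Step) from $\Delta_\mathcal{B}(P\setminus Q)\Rightarrow Q$ conclude $P\Rightarrow Q$ if $P\setminus Q$ is $\mathcal{B}$-runnable.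 For $E\subseteq\mathrm{NF}_\mathcal{A}$, an APR predicate $P\Rightarrow Q$ over $A$ is a safety APR predicate for $E$ w.r.t. $\mathcal{A}$ if $Q\cap E=\emptyset$, $\{t\in\mathrm{NF}_\mathcal{A}\setminus E\mid\exists s\in P.\ s\to_\mathcal{A}^*t\}\subseteq Q$, and $Q\subseteq\mathrm{NF}_\mathcal{A}$. *)

theory Defs
  imports Main
begin

text \<open>
  The carrier of an abstract reduction system is an explicit set, so that a fresh element can be
  added to it; hence the relation has to be required to stay inside the carrier.
\<close>

type_synonym 'a ars = "'a set \<times> 'a rel"

abbreviation carrier :: "'a ars \<Rightarrow> 'a set" where
  "carrier \<equiv> fst"

abbreviation red :: "'a ars \<Rightarrow> 'a rel" where
  "red \<equiv> snd"

definition is_ars :: "'a ars \<Rightarrow> bool" where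
  "is_ars B \<longleftrightarrow> red B \<subseteq> carrier B \<times> carrier B"

definition NF :: "'a ars \<Rightarrow> 'a set" where
  "NF B = {t \<in> carrier B. \<nexists>u. (t, u) \<in> red B}"

definition Delta :: "'a ars \<Rightarrow> 'a set \<Rightarrow> 'a set" where
  "Delta B P = {t. \<exists>s\<in>P. (s, t) \<in> red B}"

definition runnable :: "'a ars \<Rightarrow> 'a set \<Rightarrow> bool" where
  "runnable B P \<longleftrightarrow> P \<noteq> {} \<and> P \<inter> NF B = {}"

text \<open>
  An APR predicate \<open>P \<Rightarrow> Q\<close> is represented by its two components, passed as
  separate arguments.
\<close>

definition apr_over :: "'a ars \<Rightarrow> 'a set \<Rightarrow> 'a set \<Rightarrow> bool" where
  "apr_over B P Q \<longleftrightarrow> P \<subseteq> carrier B \<and> Q \<subseteq> carrier B"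

text \<open>
  The premise \<open>apr_over B P Q\<close> is not an additional side condition: it expresses that the rules
  range over the APR predicates over \<open>B\<close>.
\<close>

coinductive partially_valid :: "'a ars \<Rightarrow> 'a set \<Rightarrow> 'a set \<Rightarrow> bool" for B where
  Subsumption: "apr_over B P Q \<Longrightarrow> P \<subseteq> Q \<Longrightarrow> partially_valid B P Q"
| Step: "apr_over B P Q \<Longrightarrow> runnable B (P - Q) \<Longrightarrow>
    partially_valid B (Delta B (P - Q)) Q \<Longrightarrow> partially_valid B P Q"

definition safety_apr :: "'a ars \<Rightarrow> 'a set \<Rightarrow> 'a set \<Rightarrow> 'a set \<Rightarrow> bool" where
  "safety_apr A E P Q \<longleftrightarrow>
     apr_over A P Q \<and>
     Q \<inter> E = {} \<and>
     {t \<in> NF A - E. \<exists>s\<in>P. (s, t) \<in> (red A)\<^sup>*} \<subseteq> Q \<and>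
     Q \<subseteq> NF A"

end

theory Submission
  imports Defs
begin

text \<open>
  Partial validity of \<open>P \<Rightarrow> Q\<close> says that no path from \<open>P\<close> avoiding \<open>Q\<close> ends in a normal form outside
  \<open>Q\<close>. For a safety predicate \<open>P \<Rightarrow> Q\<close> over \<open>\<A>\<close>, the normal forms reachable from \<open>P\<close> and lying outside
  \<open>Q\<close> are exactly those in \<open>E\<close>. In \<open>\<A>'\<close> the normal forms other than \<open>any\<close> are exactly the elements
  of \<open>E\<close>, and since \<open>any\<close> is a dead end, \<open>E\<close> is reached by the same paths as in \<open>\<A>\<close>. So both sides say
  that \<open>E\<close> is unreachable from \<open>P\<close>.
\<close>

text \<open>Only the source is restricted, as in rule \<open>Step\<close>, which removes
  \<open>Q\<close> before reducing; a path may thus end in \<open>Q\<close>.\<close>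

definition red_avoiding :: "'a ars \<Rightarrow> 'a set \<Rightarrow> 'a rel" where
  "red_avoiding B Q = {(s, t) \<in> red B. s \<notin> Q}"

text \<open>Each step of the path unfolds one \<open>Step\<close>, so \<open>P\<close> must vary in
  the induction. At the end of the path, a normal form outside \<open>Q\<close> would violate
  runnability.\<close>

lemma partially_valid_NF:
  assumes "(s, t) \<in> (red_avoiding B Q)\<^sup>*" and "partially_valid B P Q" and "s \<in> P" and "t \<in> NF B"
  shows "t \<in> Q"
  using assms
proof (induction arbitrary: P rule: converse_rtrancl_induct)
  case base
  from base(1) show ?case
    by cases (use base in \<open>auto simp: runnable_def\<close>)
next
  case (step s u)
  have su: "(s, u) \<in> red B" "s \<notin> Q"
    using step.hyps by (auto simp: red_avoiding_def)
  from step.prems(1) show ?case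
  proof cases
    case Subsumption
    with su step.prems show ?thesis by blast
  next
    case Step
    have "u \<in> Delta B (P - Q)"
      using su step.prems by (auto simp: Delta_def)
    with Step step.IH step.prems show ?thesis by blast
  qed
qed

lemma partially_validI:
  assumes ars: "is_ars B" and "apr_over B P Q"
    and "\<And>s t. s \<in> P \<Longrightarrow> (s, t) \<in> (red_avoiding B Q)\<^sup>* \<Longrightarrow> t \<in> NF B \<Longrightarrow> t \<in> Q"
  shows "partially_valid B P Q"
proof -
  have "apr_over B P Q \<and> (\<forall>s\<in>P. \<forall>t\<in>NF B. (s, t) \<in> (red_avoiding B Q)\<^sup>* \<longrightarrow> t \<in> Q)"
    using assms by blast
  then show ?thesis
  proof (coinduction arbitrary: P)
    case partially_valid
    show ?case
    proof (cases "P \<subseteq> Q")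
      case True
      with partially_valid show ?thesis by blast
    next
      case False
      \<comment> \<open>The empty path already forces every normal form in \<open>P\<close> into
        \<open>Q\<close>.\<close>
      have "runnable B (P - Q)"
        using False partially_valid by (auto simp: runnable_def)
      moreover have "apr_over B (Delta B (P - Q)) Q"
        using ars partially_valid by (auto simp: apr_over_def Delta_def is_ars_def)
      moreover have "t \<in> Q"
        if u: "u \<in> Delta B (P - Q)" and "t \<in> NF B" and "(u, t) \<in> (red_avoiding B Q)\<^sup>*" for u t
      proof -
        obtain s where "s \<in> P" "(s, u) \<in> red_avoiding B Q"
          using u by (auto simp: Delta_def red_avoiding_def)
        with that partially_valid show ?thesis
          using converse_rtrancl_into_rtrancl[of s u "red_avoiding B Q" t] by simp
      qed
      ultimately show ?thesis using partially_valid by simp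
    qed
  qed
qed

lemma partially_valid_iff:
  assumes "is_ars B" and "apr_over B P Q"
  shows "partially_valid B P Q \<longleftrightarrow>
    (\<forall>s\<in>P. \<forall>t\<in>NF B. (s, t) \<in> (red_avoiding B Q)\<^sup>* \<longrightarrow> t \<in> Q)"
proof
  assume "partially_valid B P Q"
  then show "\<forall>s\<in>P. \<forall>t\<in>NF B. (s, t) \<in> (red_avoiding B Q)\<^sup>* \<longrightarrow> t \<in> Q"
    by (auto intro: partially_valid_NF)
qed (auto intro: partially_validI[OF assms])

lemma red_avoiding_NF:
  assumes "Q \<subseteq> NF B"
  shows "red_avoiding B Q = red B"
  using assms by (auto simp: red_avoiding_def NF_def)

theorem theorem25:
  fixes A :: "'a set" and R :: "'a rel" and E P Q :: "'a set" and any :: 'a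
  assumes "is_ars (A, R)"
    and "E \<subseteq> NF (A, R)"
    and "safety_apr (A, R) E P Q"
    and "any \<notin> A"
  shows "partially_valid (A, R) P Q \<longleftrightarrow>
    partially_valid (A \<union> {any}, R \<union> {(s, any) | s. s \<in> A - E}) P {any}"
proof -
  let ?R' = "R \<union> {(s, any) | s. s \<in> A - E}"
  let ?A' = "(A \<union> {any}, ?R')"
  have RA: "R \<subseteq> A \<times> A" and EA: "E \<subseteq> A" and any: "any \<notin> A"
    using assms by (auto simp: is_ars_def NF_def)
  have QNF: "Q \<subseteq> NF (A, R)" and QE: "Q \<inter> E = {}" and over: "apr_over (A, R) P Q"
    and reach: "\<And>s t. t \<in> NF (A, R) - E \<Longrightarrow> s \<in> P \<Longrightarrow> (s, t) \<in> R\<^sup>* \<Longrightarrow> t \<in> Q"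
    using assms(3) by (auto simp: safety_apr_def)
  have NF': "NF ?A' = insert any E"
    using RA EA any assms(2) by (auto simp: NF_def)
  have ars': "is_ars ?A'" and over': "apr_over ?A' P {any}"
    using RA over by (auto simp: is_ars_def apr_over_def)
  have red': "red_avoiding ?A' {any} = ?R'"
    using red_avoiding_NF[of "{any}" ?A'] NF' by simp
  \<comment> \<open>Going backwards from \<open>t\<close>, each step ends in \<open>A\<close>, hence
    not in \<open>any\<close>, so it lies in \<open>R\<close> and also starts in
    \<open>A\<close>.\<close>
  have path: "(s, t) \<in> R\<^sup>*" if "(s, t) \<in> ?R'\<^sup>*" "t \<in> A" for s t
    using that
  proof (induction rule: rtrancl_induct)
    case (step u t)
    then have "(u, t) \<in> R" using any by auto
    with step RA show ?case by (auto intro: rtrancl_into_rtrancl)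
  qed simp
  have "partially_valid (A, R) P Q \<longleftrightarrow> (\<forall>s\<in>P. \<forall>t\<in>NF (A, R). (s, t) \<in> R\<^sup>* \<longrightarrow> t \<in> Q)"
    using partially_valid_iff[OF assms(1) over] red_avoiding_NF[OF QNF] by simp
  \<comment> \<open>Safety puts reachable normal forms outside \<open>E\<close> into
    \<open>Q\<close>; those in \<open>E\<close> are never in \<open>Q\<close>.\<close>
  also have "\<dots> \<longleftrightarrow> (\<forall>s\<in>P. \<forall>t\<in>E. (s, t) \<notin> R\<^sup>*)"
    using assms(2) QE reach by blast
  also have "\<dots> \<longleftrightarrow> (\<forall>s\<in>P. \<forall>t\<in>E. (s, t) \<notin> ?R'\<^sup>*)"
  proof -
    have "(s, t) \<in> R\<^sup>* \<longleftrightarrow> (s, t) \<in> ?R'\<^sup>*" if "t \<in> E" for s t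
      using path[of s t] that EA rtrancl_mono[of R ?R'] by (meson Un_upper1 subsetD)
    then show ?thesis by simp
  qed
  also have "\<dots> \<longleftrightarrow> partially_valid ?A' P {any}"
    unfolding partially_valid_iff[OF ars' over'] NF' red' using EA any by blast
  finally show ?thesis .
qed

end
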